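(* Let $E$ be a real reflexive Banach space. Let $A\subset E$ be a closed set with $\operatorname{cl}\operatorname{int}A=A$ such that $\partial A$ is a simple smooth closed surface of codimension 1 with function of smoothness $\alpha$ and parameter of simplicity $r>0$. Let $\varepsilon_0=\sup\{t>0:\ \alpha(\tau)+\alpha(\tau/2)<\tfrac12 \text{ for all } \tau\in(0,t)\}$. Then $\partial A$ is weakly convex with modulus of nonconvexity satisfying $\gamma_{\partial A}(\varepsilon)\le\varepsilon\left(\alpha(\varepsilon)+\alpha(\varepsilon/2)\right)$ for all $\varepsilon\in[0,\min\{r,\varepsilon_0\})$.
   Context: $E^*$ is the dual, $(p,x)$ the pairing, $\partial B^*_1(0)$ the unit sphere of $E^*$, $B_r(a)$ the closed ball. For a set $S$ and $x\in S$, the normal cone $N(S,x)$ is the set of $p\in E^*$ for which there is a function $\alpha_x:[0,\operatorname{diam}S)\to[0,\infty)$ with $\lim_{t\to+0}\alpha_x(t)=0$ and $(p,x-a)\ge-\alpha_x(\|x-a\|)\,\|x-a\|\,\|p\|$ for all $a\in S$. $\partial A$ is a smooth closed surface of codimension 1 with function of smoothness $\alpha$ if: $\partial A$ is path connected; for every $x\in\partial A$ there is $p$ with $N(A,x)\cap\partial B^*_1(0)=\{p\}$, $N(\operatorname{cl}(E\setminus A),x)\cap\partial B^*_1(0)=\{-p\}$ and $N(\partial A,x)\cap\partial B^*_1(0)$ equal to the union of these two sets; and $\alpha:[0,\operatorname{diam}A)\to[0,\infty)$ with $\alpha(t)\to0$ as $t\to+0$ satisfies, for every $x\in\partial A$,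 $N(A,x)=\{p:(p,x-a)\ge-\alpha(\|x-a\|)\|x-a\|\|p\|\ \forall a\in A\}$ and $N(\operatorname{cl}(E\setminus A),x)=\{p:(p,x-a)\ge-\alpha(\|x-a\|)\|x-a\|\|p\|\ \forall a\in\operatorname{cl}(E\setminus A)\}$. It is simple with parameter $r>0$ if for every $x\in\partial A$, every unit $p\in N(\partial A,x)$, every $y\in E$ with $\|y\|=(p,y)=1$, and every 2-dimensional affine plane $L\supset\{x,x+y\}$, the set $L\cap\partial A\cap B_r(x)$ is a path connected planar curve. For closed $S$ and $\varepsilon>0$: $\gamma^0_S(\varepsilon)=\inf\{\gamma>0: B_\gamma(\frac{x_1+x_2}{2})\cap S\ne\emptyset\ \forall x_1,x_2\in S,\ \|x_1-x_2\|\le\varepsilon\}$; modulus of nonconvexity $\gamma_S(0)=0$, $\gamma_S(\varepsilon)=\lim_{\tau\downarrow\varepsilon}\gamma^0_S(\tau)$; $S$ is weakly convex on $[0,d')$ if $\gamma_S(\varepsilon)<\varepsilon/2$ for $\varepsilon\in(0,d')$. *)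

theory Defs
  imports "HOL-Analysis.Analysis" "HOL-Library.Extended_Real"
begin

definition reflexive_space :: "'a::banach itself \<Rightarrow> bool" where
  "reflexive_space _ \<longleftrightarrow>
     surj (\<lambda>x::'a. Blinfun (\<lambda>p::'a \<Rightarrow>\<^sub>L real. blinfun_apply p x))"

definition normal_cone :: "'a::real_normed_vector set \<Rightarrow> 'a \<Rightarrow> ('a \<Rightarrow>\<^sub>L real) set" where
  "normal_cone S x = {p. \<exists>ax::real \<Rightarrow> real.
      (\<forall>t\<ge>0. ax t \<ge> 0) \<and> (ax \<longlongrightarrow> 0) (at_right 0) \<and>
      (\<forall>a\<in>S. blinfun_apply p (x - a) \<ge> - ax (norm (x - a)) * norm (x - a) * norm p)}"

definition smooth_closed_surface ::
  "'a::real_normed_vector set \<Rightarrow> (real \<Rightarrow> real) \<Rightarrow> bool" where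
  "smooth_closed_surface A \<alpha> \<longleftrightarrow>
     path_connected (frontier A) \<and>
     (\<forall>t\<ge>0. \<alpha> t \<ge> 0) \<and> (\<alpha> \<longlongrightarrow> 0) (at_right 0) \<and>
     (\<forall>x\<in>frontier A.
        (\<exists>p. normal_cone A x \<inter> sphere 0 1 = {p} \<and>
             normal_cone (closure (- A)) x \<inter> sphere 0 1 = {- p} \<and>
             normal_cone (frontier A) x \<inter> sphere 0 1 = {p, - p}) \<and>
        normal_cone A x = {p. \<forall>a\<in>A.
            blinfun_apply p (x - a) \<ge> - \<alpha> (norm (x - a)) * norm (x - a) * norm p} \<and>
        normal_cone (closure (- A)) x = {p. \<forall>a\<in>closure (- A).
            blinfun_apply p (x - a) \<ge> - \<alpha> (norm (x - a)) * norm (x - a) * norm p})"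

text \<open>Simplicity with parameter r. Every 2-dimensional affine plane containing x and x+y
  is {x + s y + t z} for some z not in span{y}.\<close>
definition simple_surface :: "'a::real_normed_vector set \<Rightarrow> real \<Rightarrow> bool" where
  "simple_surface A r \<longleftrightarrow> r > 0 \<and>
     (\<forall>x\<in>frontier A. \<forall>p\<in>normal_cone (frontier A) x. norm p = 1 \<longrightarrow>
        (\<forall>y. norm y = 1 \<and> blinfun_apply p y = 1 \<longrightarrow>
          (\<forall>z. z \<notin> span {y} \<longrightarrow>
             path_connected ({x + s *\<^sub>R y + t *\<^sub>R z | s t. True} \<inter> frontier A \<inter> cball x r))))"

definition gamma0 :: "'a::real_normed_vector set \<Rightarrow> real \<Rightarrow> real" where
  "gamma0 S \<epsilon> = Inf {\<gamma>. \<gamma> > 0 \<and> (\<forall>x1\<in>S. \<forall>x2\<in>S. norm (x1 - x2) \<le> \<epsilon> \<longrightarrow>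
       cball ((1/2) *\<^sub>R (x1 + x2)) \<gamma> \<inter> S \<noteq> {})}"

definition modulus_nonconvexity :: "'a::real_normed_vector set \<Rightarrow> real \<Rightarrow> real" where
  "modulus_nonconvexity S \<epsilon> = (if \<epsilon> = 0 then 0 else Lim (at_right \<epsilon>) (gamma0 S))"

definition weakly_convex_on :: "'a::real_normed_vector set \<Rightarrow> ereal \<Rightarrow> bool" where
  "weakly_convex_on S d \<longleftrightarrow>
     (\<forall>\<epsilon>. 0 < \<epsilon> \<and> ereal \<epsilon> < d \<longrightarrow> modulus_nonconvexity S \<epsilon> < \<epsilon> / 2)"

end

theory Submission
  imports Defs
begin

text \<open>Let \<open>N x\<close> be the unit normal at \<open>x \<in> \<partial>A\<close> and let \<open>dev t\<close> be the supremum of \<open>\<bar>N x (z - x)\<bar>\<close> over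
  \<open>x, z \<in> \<partial>A\<close> with \<open>\<parallel>z - x\<parallel> = t\<close>, so that \<open>dev t \<le> t \<alpha>(t)\<close>. For \<open>x1, x2 \<in> \<partial>A\<close> at distance \<open>t\<close>, the
  sphere of radius \<open>t / 2\<close> about \<open>x1\<close> passes through the midpoint of \<open>x1\<close> and \<open>x2\<close>, and contains points
  on both sides of \<open>\<partial>A\<close> within any distance greater than \<open>dev t + 2 dev (t / 2)\<close> of that midpoint.

  As \<open>\<alpha>\<close> need be neither monotone nor continuous, the bound at \<open>\<epsilon>\<close> also requires that \<open>dev\<close> is
  nondecreasing and upper semicontinuous from the right. Monotonicity holds because a pair
  \<open>x, z\<close> nearly attaining \<open>dev t\<close> with \<open>e = z - x\<close> satisfies \<open>N z e \<le> dev t \<approx> N x e\<close>; moving \<open>z\<close> in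
  the direction \<open>e - c y\<close>, with \<open>N z y = 1\<close>, \<open>\<parallel>y\<parallel> \<approx> 1\<close> and \<open>c\<close> slightly above \<open>max (N z e) 0\<close>, stays
  in \<open>A\<close>, increases the distance from \<open>x\<close> and does not decrease \<open>N x\<close> to first order. Moving \<open>z\<close> towards
  \<open>x\<close> in the same way gives the semicontinuity.\<close>

section \<open>Near-norming vectors and growth by small steps\<close>

lemma norming_vector_blinfun:
  fixes p :: "'a::real_normed_vector \<Rightarrow>\<^sub>L real"
  assumes "norm p = 1" "\<delta> > 0"
  obtains y where "blinfun_apply p y = 1" "norm y \<le> 1 + \<delta>"
proof -
  have "\<exists>y. norm (blinfun_apply p y) > 1 / (1 + \<delta>) * norm y"
  proof (rule ccontr)
    assume "\<not> ?thesis"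
    then have "norm p \<le> 1 / (1 + \<delta>)"
      using assms by (intro norm_blinfun_bound) (auto simp: not_less)
    with assms show False by (simp add: field_simps)
  qed
  then obtain y where y: "norm y < (1 + \<delta>) * \<bar>blinfun_apply p y\<bar>"
    using assms by (auto simp: field_simps)
  then have "blinfun_apply p y \<noteq> 0"
    by (auto simp: not_less[symmetric])
  moreover have "norm (inverse (blinfun_apply p y) *\<^sub>R y) \<le> 1 + \<delta>"
    using y \<open>blinfun_apply p y \<noteq> 0\<close> by (simp add: field_simps)
  ultimately show thesis
    by (intro that[of "inverse (blinfun_apply p y) *\<^sub>R y"]) (auto simp: blinfun.scaleR_right)
qed

lemma blinfun_abs_le_norm:
  fixes p :: "'a::real_normed_vector \<Rightarrow>\<^sub>L real"
  assumes "norm p = 1"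
  shows "\<bar>blinfun_apply p v\<bar> \<le> norm v"
  using norm_blinfun[of p v] assms by simp

text \<open>Over a subdivision into steps of length at most \<open>h\<close>, the errors
  \<open>\<delta> * (s' - s)\<close> add up to \<open>\<delta> * (b - a)\<close>, which is
  arbitrarily small.\<close>

lemma le_of_small_steps:
  fixes f :: "real \<Rightarrow> real"
  assumes "a \<le> b"
    and step: "\<And>\<delta>. \<delta> > 0 \<Longrightarrow> \<exists>h>0. \<forall>s s'. a \<le> s \<and> s < s' \<and> s' \<le> b \<and> s' \<le> s + h \<longrightarrow>
                 f s \<le> f s' + \<delta> * (s' - s)"
  shows "f a \<le> f b"
proof (cases "a = b")
  case False
  with assms have ab: "a < b" by simp
  have "f a \<le> f b + \<kappa>" if "\<kappa> > 0" for \<kappa>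
  proof -
    define \<delta> where "\<delta> = \<kappa> / (b - a)"
    have "\<delta> > 0" using that ab by (simp add: \<delta>_def)
    then obtain h where h: "h > 0"
      and st: "\<And>s s'. a \<le> s \<Longrightarrow> s < s' \<Longrightarrow> s' \<le> b \<Longrightarrow> s' \<le> s + h \<Longrightarrow> f s \<le> f s' + \<delta> * (s' - s)"
      using step by blast
    obtain n :: nat where n: "(b - a) / h < n" using reals_Archimedean2 by blast
    then have n0: "n > 0"
      using h ab by (metis diff_gt_0_iff_gt divide_pos_pos gr0I less_asym of_nat_0)
    define d where "d = (b - a) / n"
    have d: "0 < d" "d \<le> h" "n * d = b - a"
      using n n0 h ab by (auto simp: d_def field_simps)
    have "f a \<le> f (a + k * d) + \<delta> * (k * d)" if "k \<le> n" for k :: nat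
      using that
    proof (induction k)
      case (Suc k)
      have "real (Suc k) * d \<le> n * d"
        using Suc.prems d by (intro mult_right_mono) auto
      then have "f (a + k * d) \<le> f (a + Suc k * d) + \<delta> * (a + Suc k * d - (a + k * d))"
        using d by (intro st) (auto simp: algebra_simps)
      with Suc show ?case by (simp add: algebra_simps)
    qed simp
    from this[of n] d have "f a \<le> f b + \<delta> * (b - a)" by simp
    then show ?thesis using ab by (simp add: \<delta>_def)
  qed
  then show ?thesis by (rule field_le_epsilon)
qed simp

section \<open>Regions with a unit normal on the frontier\<close>

text \<open>The assumptions are invariant under exchanging \<open>A\<close> with
  \<open>closure (- A)\<close> and \<open>N\<close> with \<open>- N\<close>, so each one-sided
  estimate also yields its mirror image.\<close>

locale smooth_region =
  fixes A :: "'a::real_normed_vector set" and N :: "'a \<Rightarrow> 'a \<Rightarrow>\<^sub>L real"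
    and \<alpha> :: "real \<Rightarrow> real" and T :: real
  assumes closed: "closed A" and regular: "closure (interior A) = A"
    and norm_N: "x \<in> frontier A \<Longrightarrow> norm (N x) = 1"
    and inner: "x \<in> frontier A \<Longrightarrow> a \<in> A \<Longrightarrow>
                  blinfun_apply (N x) (a - x) \<le> \<alpha> (norm (a - x)) * norm (a - x)"
    and outer: "x \<in> frontier A \<Longrightarrow> a \<in> closure (- A) \<Longrightarrow>
                  - blinfun_apply (N x) (a - x) \<le> \<alpha> (norm (a - x)) * norm (a - x)"
    and \<alpha>_tendsto: "(\<alpha> \<longlongrightarrow> 0) (at_right 0)"
    and \<alpha>_nonneg: "t \<ge> 0 \<Longrightarrow> \<alpha> t \<ge> 0"
    and \<alpha>_less: "0 < t \<Longrightarrow> t < T \<Longrightarrow> \<alpha> t < 1 / 2"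
begin

lemma closure_Compl_closure_Compl: "closure (- closure (- A)) = A"
  using regular by (simp add: interior_closure)

lemma frontier_closure_Compl: "frontier (closure (- A)) = frontier A"
  using closure_Compl_closure_Compl closed
  by (auto simp: frontier_closures)

lemma complementary: "smooth_region (closure (- A)) (\<lambda>x. - N x) \<alpha> T"
proof
  show "closure (interior (closure (- A))) = closure (- A)"
    by (metis closure_Compl_closure_Compl closure_complement double_complement)
qed (use frontier_closure_Compl closure_Compl_closure_Compl norm_N inner outer \<alpha>_tendsto
       \<alpha>_nonneg \<alpha>_less in \<open>auto simp: blinfun.minus_left\<close>)

lemma frontier_subset: "x \<in> frontier A \<Longrightarrow> x \<in> A" "x \<in> frontier A \<Longrightarrow> x \<in> closure (- A)"
  using closed by (auto simp: frontier_closures)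

text \<open>A point \<open>z + v\<close> outside \<open>A\<close> lies in
  \<open>closure (- A)\<close>, where \<open>outer\<close> bounds \<open>- N z v\<close> by
  \<open>\<alpha> (norm v) * norm v\<close>; this fails once \<alpha> is below
  \<open>\<kappa>\<close>. The radius \<open>s\<close> is uniform in \<open>z\<close> because all
  frontier points share \<alpha>.\<close>

lemma pushed_point_mem:
  assumes "\<kappa> > 0"
  obtains s where "s > 0"
    "\<And>z v. z \<in> frontier A \<Longrightarrow> v \<noteq> 0 \<Longrightarrow> norm v < s \<Longrightarrow>
        blinfun_apply (N z) v \<le> - \<kappa> * norm v \<Longrightarrow> z + v \<in> A"
proof -
  have "\<forall>\<^sub>F t in at_right 0. \<alpha> t < \<kappa>"
    using \<alpha>_tendsto assms by (simp add: order_tendsto_iff)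
  then obtain s where s: "s > 0" "\<And>t. 0 < t \<Longrightarrow> t < s \<Longrightarrow> \<alpha> t < \<kappa>"
    unfolding eventually_at_right_field by auto
  show thesis
  proof (rule that[OF s(1)], rule ccontr)
    fix z v assume z: "z \<in> frontier A" "v \<noteq> 0" "norm v < s"
      and v: "blinfun_apply (N z) v \<le> - \<kappa> * norm v" "z + v \<notin> A"
    then have "z + v \<in> closure (- A)" by (simp add: closure_def)
    from outer[OF z(1) this] v have "\<kappa> * norm v \<le> \<alpha> (norm v) * norm v" by simp
    with z s(2)[of "norm v"] show False by simp
  qed
qed

section \<open>Deviation of the frontier from its tangent planes\<close>

text \<open>The inserted \<open>0\<close> keeps the supremum meaningful at distances that no two
  frontier points realise.\<close>

definition dev :: "real \<Rightarrow> real" where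
  "dev t = Sup (insert 0 {\<bar>blinfun_apply (N x) (z - x)\<bar> | x z.
              x \<in> frontier A \<and> z \<in> frontier A \<and> norm (z - x) = t})"

lemma dev_complementary: "smooth_region.dev (closure (- A)) (\<lambda>x. - N x) = dev"
proof -
  interpret C: smooth_region "closure (- A)" "\<lambda>x. - N x" \<alpha> T by (rule complementary)
  show ?thesis
    by (simp add: fun_eq_iff C.dev_def dev_def frontier_closure_Compl blinfun.minus_left)
qed

lemma dev_bdd: "bdd_above (insert 0 {\<bar>blinfun_apply (N x) (z - x)\<bar> | x z.
              x \<in> frontier A \<and> z \<in> frontier A \<and> norm (z - x) = t})"
  by (rule bdd_aboveI[of _ "max 0 t"]) (auto dest!: blinfun_abs_le_norm[OF norm_N] simp: le_max_iff_disj
     intro: blinfun_abs_le_norm[OF norm_N])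

lemma dev_nonneg: "dev t \<ge> 0"
  unfolding dev_def by (rule cSup_upper[OF _ dev_bdd]) simp

lemma abs_le_dev:
  assumes "x \<in> frontier A" "z \<in> frontier A" "norm (z - x) = t"
  shows "\<bar>blinfun_apply (N x) (z - x)\<bar> \<le> dev t"
  unfolding dev_def by (rule cSup_upper[OF _ dev_bdd]) (use assms in auto)

lemma dev_leI:
  assumes "0 \<le> c"
    and "\<And>x z. x \<in> frontier A \<Longrightarrow> z \<in> frontier A \<Longrightarrow> norm (z - x) = t \<Longrightarrow>
            \<bar>blinfun_apply (N x) (z - x)\<bar> \<le> c"
  shows "dev t \<le> c"
  unfolding dev_def by (rule cSup_least) (use assms in auto)

lemma dev_le: "0 \<le> t \<Longrightarrow> dev t \<le> t * \<alpha> t"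
  by (rule dev_leI)
     (use \<alpha>_nonneg inner[OF _ frontier_subset(1)] outer[OF _ frontier_subset(2)]
       in \<open>auto simp: abs_le_iff mult.commute\<close>)

lemma dev_less_half: "0 < t \<Longrightarrow> t < T \<Longrightarrow> dev t < t / 2"
  using dev_le[of t] mult_strict_left_mono[OF \<alpha>_less[of t], of t] by linarith

text \<open>Sliding \<open>a\<close> along the sphere towards a near-maximiser of the normal reaches the frontier
  without decreasing the value of the normal.\<close>

lemma le_dev_of_mem:
  assumes x: "x \<in> frontier A" and a: "a \<in> A" "norm (a - x) = t" and t: "0 < t" "t < T"
  shows "blinfun_apply (N x) (a - x) \<le> dev t"
proof (cases "blinfun_apply (N x) (a - x) > 0")
  case pos: True
  let ?p = "blinfun_apply (N x)"
  obtain y where y: "?p y = 1" "norm y \<le> 1 + 1 / 2"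
    using norming_vector_blinfun[OF norm_N[OF x], of "1/2"] by auto
  have ny: "norm y \<ge> 1"
    using y blinfun_abs_le_norm[OF norm_N[OF x], of y] by simp
  have half: "\<alpha> t * t < t / 2"
    using \<alpha>_less[OF t] t mult_strict_right_mono[of "\<alpha> t" "1/2" t] by simp
  define w where "w = (t / norm y) *\<^sub>R y"
  have w: "norm w = t" "?p w = t / norm y"
    using ny t y by (auto simp: w_def blinfun.scaleR_right)
  \<comment> \<open>The bound \<open>3 / 2\<close> on \<open>norm y\<close> gives \<open>w\<close> a
    normal value of at least \<open>2 * t / 3\<close>, while points of \<open>A\<close> at distance
    \<open>t\<close> stay below \<open>t / 2\<close>.\<close>
  have "t / norm y \<ge> t / (1 + 1 / 2)"
    using ny y t by (intro divide_left_mono) auto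
  then have pw: "?p w > t / 2" using w t by simp
  have pa: "?p (a - x) < t / 2" using inner[OF x a(1)] a half by simp
  \<comment> \<open>The chord from \<open>a - x\<close> to \<open>w\<close> avoids \<open>0\<close>
    because \<open>?p\<close> is positive on it; \<open>g\<close> projects it radially to the
    sphere, giving a path from \<open>a\<close> to a point outside \<open>A\<close>.\<close>
  define v where "v = (\<lambda>s::real. (1 - s) *\<^sub>R (a - x) + s *\<^sub>R w)"
  have v: "?p (v s) \<ge> ?p (a - x)" "norm (v s) \<le> t" if "s \<in> {0..1}" for s
  proof -
    have "s * ?p (a - x) \<le> s * ?p w" using that pa pw by (intro mult_left_mono) auto
    moreover have "?p (v s) = (1 - s) * ?p (a - x) + s * ?p w"
      by (simp add: v_def blinfun.add_right blinfun.scaleR_right)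
    ultimately show "?p (v s) \<ge> ?p (a - x)"
      by (simp add: left_diff_distrib)
    have "norm (v s) \<le> \<bar>1 - s\<bar> * t + \<bar>s\<bar> * t"
      using a w unfolding v_def by (metis norm_scaleR norm_triangle_ineq)
    with that show "norm (v s) \<le> t" by (simp add: algebra_simps)
  qed
  have v0: "v s \<noteq> 0" if "s \<in> {0..1}" for s
    using v(1)[OF that] pos by (auto simp: blinfun.zero_right)
  define g where "g = (\<lambda>s. x + (t / norm (v s)) *\<^sub>R v s)"
  have "continuous_on {0..1} g"
    unfolding g_def using v0 by (intro continuous_intros) (auto simp: v_def intro!: continuous_intros)
  then have "connected (g ` {0..1})" by (intro connected_continuous_image) auto
  moreover have "a \<in> g ` {0..1}"
    using a t by (intro image_eqI[of _ _ 0]) (auto simp: g_def v_def)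
  moreover have "x + w \<in> g ` {0..1}"
    using w t by (intro image_eqI[of _ _ 1]) (auto simp: g_def v_def)
  moreover have "x + w \<notin> A" using inner[OF x, of "x + w"] w half pw by auto
  ultimately obtain s where s: "s \<in> {0..1}" "g s \<in> frontier A"
    using a connected_Int_frontier[of "g ` {0..1}" A] by blast
  have "norm (g s - x) = t" using v0[OF s(1)] t by (simp add: g_def)
  then have "?p (g s - x) \<le> dev t" using abs_le_dev[OF x s(2)] by auto
  \<comment> \<open>The chord stays in the ball of radius \<open>t\<close>, so the projection scales
    a positive value by a factor of at least \<open>1\<close>.\<close>
  moreover have "?p (v s) \<le> t / norm (v s) * ?p (v s)"
  proof -
    have "t / norm (v s) \<ge> 1" using v(2) v0 s by simp
    then show ?thesis using v(1)[OF s(1)] pos mult_right_mono[of 1 "t / norm (v s)" "?p (v s)"] by simp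
  qed
  ultimately show ?thesis using v(1)[OF s(1)] by (simp add: g_def blinfun.scaleR_right)
qed (use dev_nonneg[of t] in auto)

lemma minus_le_dev_of_mem_closure_Compl:
  assumes "x \<in> frontier A" "a \<in> closure (- A)" "norm (a - x) = t" "0 < t" "t < T"
  shows "- blinfun_apply (N x) (a - x) \<le> dev t"
proof -
  interpret C: smooth_region "closure (- A)" "\<lambda>x. - N x" \<alpha> T by (rule complementary)
  show ?thesis
    using C.le_dev_of_mem[of x a t] assms
    by (simp add: dev_complementary frontier_closure_Compl blinfun.minus_left)
qed

section \<open>Monotonicity and right semicontinuity of the deviation\<close>

text \<open>The sign \<open>\<sigma>\<close> selects a move away from \<open>x\<close> or towards
  it. Subtracting \<open>(c + \<delta>) *\<^sub>R y\<close> brings the value of \<open>N z\<close>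
  down to at most \<open>- \<delta>\<close>, so \<open>pushed_point_mem\<close> applies, at a cost
  in norm barely above \<open>dev t\<close>.\<close>

lemma moved_point:
  assumes \<delta>: "\<delta> > 0"
  obtains s where "s > 0"
    "\<And>x z t \<sigma>. x \<in> frontier A \<Longrightarrow> z \<in> frontier A \<Longrightarrow> norm (z - x) = t \<Longrightarrow> 8 * \<delta> \<le> t \<Longrightarrow> t < T \<Longrightarrow>
       \<bar>\<sigma>\<bar> = 1 \<Longrightarrow> \<exists>w. norm (w - \<sigma> *\<^sub>R (z - x)) \<le> dev t + 2 * \<delta> \<and>
                      (\<forall>h. 0 < h \<and> 2 * (h * t) < s \<longrightarrow> z + h *\<^sub>R w \<in> A)"
proof (cases "T > 0")
  case T: True
  \<comment> \<open>Since \<open>norm w < 2 * t < 2 * T\<close> below, this slope ensures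
    \<open>\<kappa> * norm w \<le> \<delta>\<close>.\<close>
  define \<kappa> where "\<kappa> = \<delta> / (2 * T)"
  have "\<kappa> > 0" using T \<delta> by (simp add: \<kappa>_def)
  then obtain s where s: "s > 0" and push: "\<And>z v. z \<in> frontier A \<Longrightarrow> v \<noteq> 0 \<Longrightarrow> norm v < s \<Longrightarrow>
        blinfun_apply (N z) v \<le> - \<kappa> * norm v \<Longrightarrow> z + v \<in> A"
    using pushed_point_mem by blast
  show thesis
  proof (rule that[OF s])
    fix x z t and \<sigma> :: real
    assume x: "x \<in> frontier A" and z: "z \<in> frontier A" and t: "norm (z - x) = t" "8 * \<delta> \<le> t" "t < T"
      and \<sigma>: "\<bar>\<sigma>\<bar> = 1"
    let ?q = "blinfun_apply (N z)"
    obtain y where y: "?q y = 1" "norm y \<le> 1 + \<delta> / T"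
      using norming_vector_blinfun[OF norm_N[OF z], of "\<delta> / T"] \<delta> T by auto
    define c where "c = max (?q (\<sigma> *\<^sub>R (z - x))) 0"
    define w where "w = \<sigma> *\<^sub>R (z - x) - (c + \<delta>) *\<^sub>R y"
    have "\<bar>?q (\<sigma> *\<^sub>R (z - x))\<bar> = \<bar>?q (x - z)\<bar>"
      using \<sigma> by (simp add: blinfun.scaleR_right abs_mult blinfun.diff_right abs_minus_commute)
    then have "\<bar>?q (\<sigma> *\<^sub>R (z - x))\<bar> \<le> dev t"
      using abs_le_dev[OF z x, of t] t by (simp add: norm_minus_commute)
    then have c: "0 \<le> c" "c \<le> dev t"
      using dev_nonneg[of t] by (auto simp: c_def)
    have t0: "0 < t" using \<delta> t by linarith
    then have half: "dev t < t / 2" using dev_less_half t by simp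
    have qw: "?q w \<le> - \<delta>"
      by (simp add: w_def c_def blinfun.diff_right[of _ "\<sigma> *\<^sub>R (z - x)"] blinfun.scaleR_right[of _ "c + \<delta>"]
        blinfun.scaleR_right[of _ "max _ _ + \<delta>"] y)
    have "norm (w - \<sigma> *\<^sub>R (z - x)) = (c + \<delta>) * norm y"
      using c \<delta> by (simp add: w_def)
    also have "\<dots> \<le> (c + \<delta>) * (1 + \<delta> / T)"
      using y c \<delta> by (intro mult_left_mono) auto
    also have "\<dots> = c + \<delta> + (c + \<delta>) * \<delta> / T" by (simp add: algebra_simps add_divide_distrib)
    also have "(c + \<delta>) * \<delta> / T \<le> T * \<delta> / T"
      using c half t \<delta> T by (intro divide_right_mono mult_right_mono) auto
    finally have w: "norm (w - \<sigma> *\<^sub>R (z - x)) \<le> dev t + 2 * \<delta>" using c T by simp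
    have "norm w \<le> norm (w - \<sigma> *\<^sub>R (z - x)) + norm (\<sigma> *\<^sub>R (z - x))"
      by (metis diff_add_cancel norm_triangle_ineq)
    also have "norm (\<sigma> *\<^sub>R (z - x)) = t" using \<sigma> t by simp
    finally have nw: "norm w < 2 * t" using w half t t0 \<delta> by linarith
    have "z + h *\<^sub>R w \<in> A" if h: "0 < h" "2 * (h * t) < s" for h
    proof (rule push[OF z])
      have "w \<noteq> 0" using qw \<delta> by (auto simp: blinfun.zero_right)
      then show "h *\<^sub>R w \<noteq> 0" using h by simp
      have "h * norm w < h * (2 * t)" using nw h by (intro mult_strict_left_mono) auto
      with h have "h * norm w < s" by linarith
      then show "norm (h *\<^sub>R w) < s" using h by simp
      have "\<kappa> * norm w \<le> \<kappa> * (2 * T)" using nw t \<open>\<kappa> > 0\<close> by (intro mult_left_mono) auto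
      also have "\<dots> = \<delta>" using T by (simp add: \<kappa>_def)
      finally have "h * ?q w \<le> h * (- \<kappa> * norm w)" using qw h by (intro mult_left_mono) auto
      then show "?q (h *\<^sub>R w) \<le> - \<kappa> * norm (h *\<^sub>R w)"
        using h by (simp add: blinfun.scaleR_right algebra_simps)
    qed
    with w show "\<exists>w. norm (w - \<sigma> *\<^sub>R (z - x)) \<le> dev t + 2 * \<delta> \<and>
                      (\<forall>h. 0 < h \<and> 2 * (h * t) < s \<longrightarrow> z + h *\<^sub>R w \<in> A)" by blast
  qed
next
  case False
  \<comment> \<open>For \<open>T \<le> 0\<close> the conditions \<open>8 * \<delta> \<le> t\<close>
    and \<open>t < T\<close> contradict each other.\<close>
  show thesis by (rule that[of 1]) (use False \<delta> in auto)
qed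

text \<open>Moving \<open>z\<close> away from \<open>x\<close> up to distance \<open>t'\<close>
  gives a point of \<open>A\<close>, where \<open>le_dev_of_mem\<close> bounds the normal value by
  \<open>dev t'\<close>. The terms in \<open>4 * (t' - t) / t\<close> cancel as
  \<open>N x (z - x)\<close> approaches \<open>dev t\<close>, leaving only the error
  \<open>\<delta> * (t' - t)\<close>.\<close>

lemma dev_step_up_aux:
  assumes t0: "t0 > 0" and \<delta>: "\<delta> > 0"
  obtains k where "k > 0"
    "\<And>t t' x z. t0 \<le> t \<Longrightarrow> t < t' \<Longrightarrow> t' \<le> t + k \<Longrightarrow> t' < T \<Longrightarrow> x \<in> frontier A \<Longrightarrow> z \<in> frontier A \<Longrightarrow>
       norm (z - x) = t \<Longrightarrow> blinfun_apply (N x) (z - x) * (1 + 4 * (t' - t) / t)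
          \<le> dev t' + \<delta> * (t' - t) + 4 * (t' - t) / t * dev t"
proof -
  \<comment> \<open>The first bound gives \<open>8 * d \<le> t\<close>, the second makes the error
    \<open>2 * (K * d)\<close> at most \<open>\<delta> * (t' - t)\<close>.\<close>
  define d where "d = min (t0 / 8) (\<delta> * t0 / 8)"
  have "d > 0" using t0 \<delta> by (simp add: d_def)
  then obtain s where s: "s > 0" and mv:
    "\<And>x z t \<sigma>. x \<in> frontier A \<Longrightarrow> z \<in> frontier A \<Longrightarrow> norm (z - x) = t \<Longrightarrow> 8 * d \<le> t \<Longrightarrow> t < T \<Longrightarrow>
       \<bar>\<sigma>\<bar> = 1 \<Longrightarrow> \<exists>w. norm (w - \<sigma> *\<^sub>R (z - x)) \<le> dev t + 2 * d \<and>
                      (\<forall>h. 0 < h \<and> 2 * (h * t) < s \<longrightarrow> z + h *\<^sub>R w \<in> A)"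
    using moved_point by blast
  show thesis
  \<comment> \<open>The step satisfies \<open>2 * (h * t) \<le> 2 * (K * t) = 8 * (t' - t)\<close>,
    which is then below \<open>s\<close>.\<close>
  proof (rule that[of "s / 9"])
    fix t t' x z
    assume t: "t0 \<le> t" "t < t'" "t' \<le> t + s / 9" "t' < T"
      and x: "x \<in> frontier A" and z: "z \<in> frontier A" and e: "norm (z - x) = t"
    define K where "K = 4 * (t' - t) / t"
    have tp: "t > 0" using t t0 by linarith
    have K: "K \<ge> 0" "K * t = 4 * (t' - t)" using t tp by (auto simp: K_def)
    have d8: "8 * d \<le> t" using t by (simp add: d_def min_def)
    have half: "dev t < t / 2" using dev_less_half[of t] t tp by simp
    obtain w where w: "norm (w - (z - x)) \<le> dev t + 2 * d"
      and mem: "\<And>h. 0 < h \<Longrightarrow> 2 * (h * t) < s \<Longrightarrow> z + h *\<^sub>R w \<in> A"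
      using mv[OF x z e d8, of 1] t by auto
    \<comment> \<open>As \<open>w\<close> differs from \<open>z - x\<close> by at most
      \<open>3 * t / 4\<close>, the distance exceeds \<open>t\<close> by at least
      \<open>h * t / 4\<close>; \<open>K\<close> is the step for which this reaches
      \<open>t'\<close>.\<close>
    have low: "t + h * t / 4 \<le> norm (z - x + h *\<^sub>R w)" if "h \<ge> 0" for h
    proof -
      have "(1 + h) * t = norm ((1 + h) *\<^sub>R (z - x))" using that e by simp
      also have "\<dots> = norm (z - x + h *\<^sub>R w - h *\<^sub>R (w - (z - x)))"
        by (simp add: algebra_simps)
      also have "\<dots> \<le> norm (z - x + h *\<^sub>R w) + h * norm (w - (z - x))"
        using norm_triangle_ineq4[of "z - x + h *\<^sub>R w" "h *\<^sub>R (w - (z - x))"] that by simp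
      also have "h * norm (w - (z - x)) \<le> h * (3 * t / 4)"
        using that w half d8 by (intro mult_left_mono) auto
      finally show ?thesis by (simp add: algebra_simps)
    qed
    have "t' \<le> norm (z - x + K *\<^sub>R w)" 
    proof -
      have "K * t / 4 = t' - t" using K by simp
      then show ?thesis using low[OF K(1)] by linarith
    qed
    then have "\<exists>h\<ge>0. h \<le> K \<and> norm (z - x + h *\<^sub>R w) = t'"
      using K e t by (intro IVT') (auto intro!: continuous_intros)
    then obtain h where h: "0 \<le> h" "h \<le> K" "norm (z - x + h *\<^sub>R w) = t'" by blast
    have "h \<noteq> 0" using h e t by auto
    have ht: "h * t \<le> K * t" using h tp by (intro mult_right_mono) auto
    have "z + h *\<^sub>R w \<in> A"
      by (rule mem) (use ht K t h \<open>h \<noteq> 0\<close> s in auto)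
    then have "blinfun_apply (N x) (z + h *\<^sub>R w - x) \<le> dev t'"
      using le_dev_of_mem[OF x, of "z + h *\<^sub>R w" t'] h t tp by (simp add: algebra_simps)
    moreover have "z + h *\<^sub>R w - x = (1 + h) *\<^sub>R (z - x) + h *\<^sub>R (w - (z - x))"
      by (simp add: algebra_simps)
    then have "blinfun_apply (N x) (z + h *\<^sub>R w - x) =
        (1 + h) * blinfun_apply (N x) (z - x) + h * blinfun_apply (N x) (w - (z - x))"
      by (simp only: blinfun.add_right blinfun.scaleR_right real_scaleR_def)
    moreover have "- blinfun_apply (N x) (w - (z - x)) \<le> dev t + 2 * d"
      using blinfun_abs_le_norm[OF norm_N[OF x], of "w - (z - x)"] w by linarith
    then have "h * (- blinfun_apply (N x) (w - (z - x))) \<le> h * (dev t + 2 * d)"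
      using h by (intro mult_left_mono) auto
    moreover define P where "P = blinfun_apply (N x) (z - x)"
    ultimately have "P \<le> dev t' + h * (dev t - P + 2 * d)"
      by (simp add: algebra_simps)
    also have "h * (dev t - P + 2 * d) \<le> K * (dev t - P + 2 * d)"
      using h abs_le_dev[OF x z e] \<open>d > 0\<close> by (intro mult_right_mono) (auto simp: P_def)
    also have "K * (dev t - P + 2 * d) = K * (dev t - P) + 2 * (K * d)"
      by (simp add: algebra_simps)
    also have "2 * (K * d) \<le> \<delta> * (t' - t)"
    proof -
      have "\<delta> * t0 \<le> \<delta> * t" using \<delta> t by simp
      then have "K * d \<le> K * (\<delta> * t / 8)"
        using K by (intro mult_left_mono) (auto simp: d_def)
      also have "\<dots> = \<delta> * (K * t) / 8" by simp
      also have "\<dots> = \<delta> * (t' - t) / 2" unfolding K(2) by simp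
      finally show ?thesis by linarith
    qed
    finally show "blinfun_apply (N x) (z - x) * (1 + 4 * (t' - t) / t)
          \<le> dev t' + \<delta> * (t' - t) + 4 * (t' - t) / t * dev t"
      unfolding K_def[symmetric] P_def[symmetric] by (simp add: algebra_simps)
  qed (use s in simp)
qed

text \<open>The estimates for \<open>A\<close> and for \<open>closure (- A)\<close> cover both signs
  of the normal value. Dividing by \<open>1 + K\<close> before taking the supremum lets the
  \<open>K * dev t\<close> terms cancel.\<close>

lemma dev_step_up:
  assumes t0: "t0 > 0" and \<delta>: "\<delta> > 0"
  shows "\<exists>k>0. \<forall>t t'. t0 \<le> t \<and> t < t' \<and> t' < T \<and> t' \<le> t + k \<longrightarrow> dev t \<le> dev t' + \<delta> * (t' - t)"
proof -
  interpret C: smooth_region "closure (- A)" "\<lambda>x. - N x" \<alpha> T by (rule complementary)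
  obtain k1 where k1: "k1 > 0"
    "\<And>t t' x z. t0 \<le> t \<Longrightarrow> t < t' \<Longrightarrow> t' \<le> t + k1 \<Longrightarrow> t' < T \<Longrightarrow> x \<in> frontier A \<Longrightarrow> z \<in> frontier A \<Longrightarrow>
       norm (z - x) = t \<Longrightarrow> blinfun_apply (N x) (z - x) * (1 + 4 * (t' - t) / t)
          \<le> dev t' + \<delta> * (t' - t) + 4 * (t' - t) / t * dev t"
    using dev_step_up_aux[OF assms] by blast
  obtain k2 where k2: "k2 > 0"
    "\<And>t t' x z. t0 \<le> t \<Longrightarrow> t < t' \<Longrightarrow> t' \<le> t + k2 \<Longrightarrow> t' < T \<Longrightarrow> x \<in> frontier A \<Longrightarrow> z \<in> frontier A \<Longrightarrow>
       norm (z - x) = t \<Longrightarrow> (- blinfun_apply (N x) (z - x)) * (1 + 4 * (t' - t) / t)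
          \<le> dev t' + \<delta> * (t' - t) + 4 * (t' - t) / t * dev t"
    using C.dev_step_up_aux[OF assms]
    unfolding dev_complementary frontier_closure_Compl blinfun.minus_left by blast
  have "dev t \<le> dev t' + \<delta> * (t' - t)"
    if t: "t0 \<le> t" "t < t'" "t' < T" "t' \<le> t + min k1 k2" for t t'
  proof -
    define K where "K = 4 * (t' - t) / t"
    have K: "K \<ge> 0" using t t0 by (simp add: K_def)
    have "dev t \<le> (dev t' + \<delta> * (t' - t) + K * dev t) / (1 + K)"
    proof (rule dev_leI)
      show "0 \<le> (dev t' + \<delta> * (t' - t) + K * dev t) / (1 + K)"
        using K t \<delta> dev_nonneg by auto
      fix x z assume "x \<in> frontier A" "z \<in> frontier A" "norm (z - x) = t"
      then have "\<bar>blinfun_apply (N x) (z - x)\<bar> * (1 + K) \<le> dev t' + \<delta> * (t' - t) + K * dev t"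
        using k1(2)[of t t' x z] k2(2)[of t t' x z] t by (auto simp: K_def abs_if)
      then show "\<bar>blinfun_apply (N x) (z - x)\<bar> \<le> (dev t' + \<delta> * (t' - t) + K * dev t) / (1 + K)"
        using K by (simp add: pos_le_divide_eq)
    qed
    then show ?thesis using K by (simp add: pos_le_divide_eq algebra_simps)
  qed
  then show ?thesis using k1(1) k2(1) by (intro exI[of _ "min k1 k2"]) auto
qed

lemma dev_mono:
  assumes "0 < t" "t \<le> t'" "t' < T"
  shows "dev t \<le> dev t'"
proof (rule le_of_small_steps[OF assms(2)])
  fix \<delta> :: real assume "\<delta> > 0"
  from dev_step_up[OF assms(1) this] assms(3)
  show "\<exists>h>0. \<forall>s s'. t \<le> s \<and> s < s' \<and> s' \<le> t' \<and> s' \<le> s + h \<longrightarrow> dev s \<le> dev s' + \<delta> * (s' - s)"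
    by (meson le_less_trans)
qed

text \<open>Here \<open>z\<close> moves towards \<open>x\<close> until the distance is
  \<open>\<epsilon>\<close>. The normal value drops by at most \<open>2 * (h * t)\<close> with
  \<open>h * t \<le> 4 * (\<tau> - \<epsilon>)\<close>, whence the constant
  \<open>8\<close>.\<close>

lemma dev_step_down_aux:
  assumes \<epsilon>: "0 < \<epsilon>"
  obtains k where "k > 0"
    "\<And>\<tau> x z. \<epsilon> < \<tau> \<Longrightarrow> \<tau> \<le> \<epsilon> + k \<Longrightarrow> \<tau> < T \<Longrightarrow> x \<in> frontier A \<Longrightarrow> z \<in> frontier A \<Longrightarrow>
       norm (z - x) = \<tau> \<Longrightarrow> blinfun_apply (N x) (z - x) \<le> dev \<epsilon> + 8 * (\<tau> - \<epsilon>)"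
proof -
  define d where "d = \<epsilon> / 8"
  have "d > 0" using \<epsilon> by (simp add: d_def)
  then obtain s where s: "s > 0" and mv:
    "\<And>x z t \<sigma>. x \<in> frontier A \<Longrightarrow> z \<in> frontier A \<Longrightarrow> norm (z - x) = t \<Longrightarrow> 8 * d \<le> t \<Longrightarrow> t < T \<Longrightarrow>
       \<bar>\<sigma>\<bar> = 1 \<Longrightarrow> \<exists>w. norm (w - \<sigma> *\<^sub>R (z - x)) \<le> dev t + 2 * d \<and>
                      (\<forall>h. 0 < h \<and> 2 * (h * t) < s \<longrightarrow> z + h *\<^sub>R w \<in> A)"
    using moved_point by blast
  show thesis
  \<comment> \<open>The bound \<open>\<epsilon> / 4\<close> ensures \<open>K \<le> 1\<close>, so
    that \<open>1 - h\<close> stays nonnegative along the move.\<close>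
  proof (rule that[of "min (s / 9) (\<epsilon> / 4)"])
    fix t x z
    assume t: "\<epsilon> < t" "t \<le> \<epsilon> + min (s / 9) (\<epsilon> / 4)" "t < T"
      and x: "x \<in> frontier A" and z: "z \<in> frontier A" and e: "norm (z - x) = t"
    define K where "K = 4 * (t - \<epsilon>) / t"
    have tp: "t > 0" using t \<epsilon> by linarith
    have K: "0 \<le> K" "K \<le> 1" "K * t = 4 * (t - \<epsilon>)" using t tp by (auto simp: K_def field_simps)
    have d8: "8 * d \<le> t" using t by (simp add: d_def)
    have half: "dev t < t / 2" using dev_less_half[of t] t tp by simp
    obtain w where w: "norm (w + (z - x)) \<le> dev t + 2 * d"
      and mem: "\<And>h. 0 < h \<Longrightarrow> 2 * (h * t) < s \<Longrightarrow> z + h *\<^sub>R w \<in> A"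
      using mv[OF x z e d8, of "-1"] t by (auto simp: algebra_simps)
    have w': "norm (w + (z - x)) \<le> 3 * t / 4" using w half d8 by linarith
    have split: "z + h *\<^sub>R w - x = (1 - h) *\<^sub>R (z - x) + h *\<^sub>R (w + (z - x))" for h
      by (simp add: algebra_simps)
    have "norm (z + K *\<^sub>R w - x) \<le> (1 - K) * t + K * norm (w + (z - x))"
      unfolding split using K e by (metis abs_of_nonneg diff_ge_0_iff_ge norm_scaleR norm_triangle_ineq)
    also have "K * norm (w + (z - x)) \<le> K * (3 * t / 4)"
      using K w' by (intro mult_left_mono) auto
    also have "(1 - K) * t + K * (3 * t / 4) = t - K * t / 4" by (simp add: algebra_simps)
    also have "K * t / 4 = t - \<epsilon>" using K(3) by simp
    finally have "norm (z + K *\<^sub>R w - x) \<le> \<epsilon>" by simp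
    then have "\<exists>h\<ge>0. h \<le> K \<and> norm (z + h *\<^sub>R w - x) = \<epsilon>"
      using K e t by (intro IVT2') (auto intro!: continuous_intros)
    then obtain h where h: "0 \<le> h" "h \<le> K" "norm (z + h *\<^sub>R w - x) = \<epsilon>" by blast
    have "h \<noteq> 0" using h e t by auto
    have ht: "h * t \<le> K * t" using h tp by (intro mult_right_mono) auto
    have "z + h *\<^sub>R w \<in> A"
      by (rule mem) (use ht K t h \<open>h \<noteq> 0\<close> s in auto)
    then have "blinfun_apply (N x) (z + h *\<^sub>R w - x) \<le> dev \<epsilon>"
      using le_dev_of_mem[OF x, of "z + h *\<^sub>R w" \<epsilon>] h t \<epsilon> by simp
    moreover have "blinfun_apply (N x) (z + h *\<^sub>R w - x) =
        (1 - h) * blinfun_apply (N x) (z - x) + h * blinfun_apply (N x) (w + (z - x))"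
      unfolding split by (simp only: blinfun.add_right blinfun.scaleR_right real_scaleR_def)
    moreover have "h * (- blinfun_apply (N x) (w + (z - x))) \<le> h * t"
      using h w' tp blinfun_abs_le_norm[OF norm_N[OF x], of "w + (z - x)"]
      by (intro mult_left_mono) auto
    moreover have "h * blinfun_apply (N x) (z - x) \<le> h * t"
      using h e blinfun_abs_le_norm[OF norm_N[OF x], of "z - x"] by (intro mult_left_mono) auto
    ultimately have "blinfun_apply (N x) (z - x) \<le> dev \<epsilon> + 2 * (h * t)"
      by (simp add: left_diff_distrib)
    with ht K show "blinfun_apply (N x) (z - x) \<le> dev \<epsilon> + 8 * (t - \<epsilon>)" by linarith
  qed (use s \<epsilon> in simp)
qed

lemma dev_step_down:
  assumes \<epsilon>: "0 < \<epsilon>"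
  obtains k where "k > 0" "\<And>\<tau>. \<epsilon> < \<tau> \<Longrightarrow> \<tau> \<le> \<epsilon> + k \<Longrightarrow> \<tau> < T \<Longrightarrow> dev \<tau> \<le> dev \<epsilon> + 8 * (\<tau> - \<epsilon>)"
proof -
  interpret C: smooth_region "closure (- A)" "\<lambda>x. - N x" \<alpha> T by (rule complementary)
  obtain k1 where k1: "k1 > 0"
    "\<And>\<tau> x z. \<epsilon> < \<tau> \<Longrightarrow> \<tau> \<le> \<epsilon> + k1 \<Longrightarrow> \<tau> < T \<Longrightarrow> x \<in> frontier A \<Longrightarrow> z \<in> frontier A \<Longrightarrow>
       norm (z - x) = \<tau> \<Longrightarrow> blinfun_apply (N x) (z - x) \<le> dev \<epsilon> + 8 * (\<tau> - \<epsilon>)"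
    using dev_step_down_aux[OF assms] by blast
  obtain k2 where k2: "k2 > 0"
    "\<And>\<tau> x z. \<epsilon> < \<tau> \<Longrightarrow> \<tau> \<le> \<epsilon> + k2 \<Longrightarrow> \<tau> < T \<Longrightarrow> x \<in> frontier A \<Longrightarrow> z \<in> frontier A \<Longrightarrow>
       norm (z - x) = \<tau> \<Longrightarrow> - blinfun_apply (N x) (z - x) \<le> dev \<epsilon> + 8 * (\<tau> - \<epsilon>)"
    using C.dev_step_down_aux[OF assms]
    unfolding dev_complementary frontier_closure_Compl blinfun.minus_left by blast
  show thesis
  proof (rule that[of "min k1 k2"])
    fix \<tau> assume \<tau>: "\<epsilon> < \<tau>" "\<tau> \<le> \<epsilon> + min k1 k2" "\<tau> < T"
    show "dev \<tau> \<le> dev \<epsilon> + 8 * (\<tau> - \<epsilon>)"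
      by (rule dev_leI)
         (use \<tau> k1(2)[of \<tau>] k2(2)[of \<tau>] dev_nonneg[of \<epsilon>] in \<open>auto simp: abs_le_iff\<close>)
  qed (use k1 k2 in simp)
qed

section \<open>Frontier points near midpoints\<close>

text \<open>The vector \<open>(x2 - x1) / 2\<close> is tilted along the normal at \<open>x1\<close> and rescaled to its original
  length \<open>t / 2\<close>, just far enough that \<open>dev (t / 2)\<close> forces the new point out of \<open>A\<close>.\<close>

lemma point_outside_near_midpoint:
  assumes x1: "x1 \<in> frontier A" and x2: "x2 \<in> frontier A"
    and t: "norm (x2 - x1) = t" "0 < t" "t < T" and g: "dev t + 2 * dev (t / 2) < g"
  obtains w where "w \<notin> A" "norm (w - (1/2) *\<^sub>R (x1 + x2)) \<le> g"
proof -
  let ?p = "blinfun_apply (N x1)"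
  define R where "R = t / 2"
  define u where "u = (1/2) *\<^sub>R (x2 - x1)"
  \<comment> \<open>\<open>a\<close> bounds the normal value of \<open>u\<close>, and
    \<open>b\<close> exceeds \<open>dev R\<close> by a slack \<open>m\<close> small enough for
    \<open>2 * (a + b) < g\<close> and \<open>b < 3 * R / 4\<close>.\<close>
  define a where "a = dev t / 2"
  define m where "m = min ((g - dev t - 2 * dev R) / 4) (R / 4)"
  define b where "b = dev R + m"
  have R: "0 < R" "R < T" using t by (auto simp: R_def)
  have u: "norm u = R" using t by (simp add: u_def R_def)
  have pu: "\<bar>?p u\<bar> \<le> a"
    using abs_le_dev[OF x1 x2 t(1)] by (simp add: u_def a_def blinfun.scaleR_right)
  have a0: "a \<ge> 0" using dev_nonneg by (simp add: a_def)
  have g': "dev t + 2 * dev R < g" using g by (simp add: R_def)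
  have m: "0 < m" "m \<le> R / 4" "4 * m \<le> g - dev t - 2 * dev R"
    using g' R by (auto simp: m_def min_def)
  have b: "dev R < b" "b < 3 * R / 4"
    using m dev_less_half[OF R] by (auto simp: b_def)
  have ab: "2 * (a + b) < g" using m g' by (simp add: a_def b_def)
  have b0: "b > 0" using b dev_nonneg[of R] by linarith
  \<comment> \<open>The bound \<open>1 / 10\<close> serves the choice of \<open>S\<close> in the
    last case; the other one absorbs \<open>norm y\<close> into \<open>g\<close>.\<close>
  define \<delta> where "\<delta> = min (1 / 10) (g / (2 * (a + b)) - 1)"
  have "\<delta> > 0" using ab a0 b0 by (simp add: \<delta>_def)
  then obtain y where y: "?p y = 1" "norm y \<le> 1 + \<delta>"
    using norming_vector_blinfun[OF norm_N[OF x1]] by blast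
  have "\<delta> \<le> 1 / 10" "\<delta> \<le> g / (2 * (a + b)) - 1" unfolding \<delta>_def by (rule min.cobounded1 min.cobounded2)+
  then have y1: "norm y \<le> 11 / 10" and "norm y \<le> g / (2 * (a + b))" using y by linarith+
  then have yg: "2 * (a + b) * norm y \<le> g" using a0 b0 by (simp add: field_simps)
  note found = that
  \<comment> \<open>Rescaled to length \<open>R\<close>, \<open>v\<close> has normal value at least
    \<open>b > dev R\<close>, which \<open>le_dev_of_mem\<close> forbids for points of
    \<open>A\<close>.\<close>
  have exit: thesis if v: "v \<noteq> 0" "b * norm v \<le> ?p v * R"
    and near: "norm ((R / norm v) *\<^sub>R v - u) \<le> 2 * (a + b) * norm y" for v
  proof (rule found)
    define w where "w = x1 + (R / norm v) *\<^sub>R v"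
    have "b \<le> ?p (w - x1)" using v R by (simp add: w_def blinfun.scaleR_right field_simps)
    moreover have "norm (w - x1) = R" using v R by (simp add: w_def)
    ultimately show "w \<notin> A" using le_dev_of_mem[OF x1, of w R] R b by force
    have "w - (1/2) *\<^sub>R (x1 + x2) = (R / norm v) *\<^sub>R v - u"
    proof -
      have "x1 = (1/2) *\<^sub>R x1 + (1/2) *\<^sub>R x1" by (simp flip: scaleR_left.add)
      then show ?thesis by (simp add: w_def u_def algebra_simps)
    qed
    then show "norm (w - (1/2) *\<^sub>R (x1 + x2)) \<le> g" using near yg by simp
  qed
  define v where "v = (\<lambda>s::real. u + s *\<^sub>R y)"
  have pv: "?p (v s) = ?p u + s" for s
    using y by (simp add: v_def blinfun.add_right blinfun.scaleR_right)
  have nv: "norm (v s) \<le> R + s * norm y" "R \<le> norm (v s) + s * norm y" if "s \<ge> 0" for s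
    using that u norm_triangle_ineq[of u "s *\<^sub>R y"] norm_triangle_ineq4[of "v s" "s *\<^sub>R y"]
    by (auto simp: v_def)
  have v0: "v s \<noteq> 0" if "s \<ge> a + b" for s
  proof -
    have "?p (v s) > 0" using pv[of s] pu b0 that by linarith
    then show ?thesis by (auto simp: blinfun.zero_right)
  qed
  define s0 where "s0 = a + b"
  have s0: "s0 > 0" using a0 b0 by (simp add: s0_def)
  \<comment> \<open>When rescaling shrinks \<open>v s\<close>, the displacement from
    \<open>u\<close> is at most \<open>2 * (s * R / norm (v s)) * norm y\<close>; the last
    hypothesis bounds the quotient by \<open>a + b\<close>.\<close>
  have big: thesis if s: "s \<ge> s0" "norm (v s) \<ge> R" "b * norm (v s) \<le> ?p (v s) * R"
      "s * R \<le> (a + b) * norm (v s)" for s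
  proof (rule exit[OF v0 s(3)])
    show "a + b \<le> s" using s by (simp add: s0_def)
    have n0: "norm (v s) > 0" using s R by linarith
    have "(R / norm (v s)) *\<^sub>R v s - u
        = (R / norm (v s) - 1) *\<^sub>R u + (R / norm (v s) * s) *\<^sub>R y"
      by (simp add: v_def algebra_simps)
    then have "norm ((R / norm (v s)) *\<^sub>R v s - u)
        \<le> norm ((R / norm (v s) - 1) *\<^sub>R u) + norm ((R / norm (v s) * s) *\<^sub>R y)"
      by (metis norm_triangle_ineq)
    also have "\<dots> = (1 - R / norm (v s)) * R + R / norm (v s) * s * norm y"
    proof -
      have "R / norm (v s) \<le> 1" using s n0 by simp
      then show ?thesis using u R s s0 by simp
    qed
    also have "(1 - R / norm (v s)) * R = R / norm (v s) * (norm (v s) - R)"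
      using n0 by (simp add: field_simps)
    also have "\<dots> \<le> R / norm (v s) * (s * norm y)"
      using R nv(1)[of s] s s0 by (intro mult_left_mono) auto
    also have "R / norm (v s) * (s * norm y) + R / norm (v s) * s * norm y
        = 2 * (s * R / norm (v s)) * norm y" by (simp add: algebra_simps)
    also have "\<dots> \<le> 2 * (a + b) * norm y"
      using s(4) n0 by (intro mult_right_mono mult_left_mono) (auto simp: pos_divide_le_eq)
    finally show "norm ((R / norm (v s)) *\<^sub>R v s - u) \<le> 2 * (a + b) * norm y" by simp
  qed
  \<comment> \<open>The tilt \<open>s0\<close> makes \<open>?p (v s0)\<close> at least
    \<open>b\<close>. If rescaling a long \<open>v s0\<close> loses this, the tilt is increased
    until the rescaled value is exactly \<open>b\<close>.\<close>
  consider "norm (v s0) \<le> R" | "norm (v s0) > R" "b * norm (v s0) \<le> ?p (v s0) * R"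
    | "b * norm (v s0) > ?p (v s0) * R" by linarith
  then show thesis
  proof cases
    case 1
    show thesis
    proof (rule exit[OF v0])
      show "a + b \<le> s0" by (simp add: s0_def)
      have "b * norm (v s0) \<le> b * R" using 1 b0 by simp
      also have "\<dots> \<le> ?p (v s0) * R" using pv[of s0] pu R by (simp add: s0_def)
      finally show "b * norm (v s0) \<le> ?p (v s0) * R" .
      have n0: "norm (v s0) > 0" using v0[of s0] by (simp add: s0_def)
      have "(R / norm (v s0)) *\<^sub>R v s0 - u = (R / norm (v s0) - 1) *\<^sub>R v s0 + s0 *\<^sub>R y"
        by (simp add: v_def algebra_simps)
      then have "norm ((R / norm (v s0)) *\<^sub>R v s0 - u)
          \<le> norm ((R / norm (v s0) - 1) *\<^sub>R v s0) + norm (s0 *\<^sub>R y)"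
        by (metis norm_triangle_ineq)
      also have "norm ((R / norm (v s0) - 1) *\<^sub>R v s0) = (R / norm (v s0) - 1) * norm (v s0)"
        using 1 n0 by simp
      also have "\<dots> = R - norm (v s0)" using n0 by (simp add: field_simps)
      also have "norm (s0 *\<^sub>R y) = s0 * norm y" using s0 by simp
      finally have "norm ((R / norm (v s0)) *\<^sub>R v s0 - u) \<le> 2 * (s0 * norm y)"
        using nv(2)[of s0] s0 by linarith
      then show "norm ((R / norm (v s0)) *\<^sub>R v s0 - u) \<le> 2 * (a + b) * norm y"
        by (simp only: s0_def mult.assoc)
    qed
  next
    case 2
    show thesis
      by (rule big[of s0]) (use 2 s0 in \<open>auto simp: s0_def mult_left_mono\<close>)
  next
    case 3
    \<comment> \<open>\<open>b * norm (v s)\<close> is bounded by a linear function of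
      \<open>s\<close> of slope \<open>33 * R / 40\<close>, below the slope \<open>R\<close> of
      \<open>?p (v s) * R\<close>, so a large tilt reverses the inequality.\<close>
    define S where "S = s0 + 100 * (R + a)"
    have SS: "S \<ge> s0" "S > 0" "S \<ge> 100 * R + 100 * a" using R a0 s0 by (auto simp: S_def)
    have "b * norm (v S) \<le> 3 * R / 4 * (R + S * (11 / 10))"
    proof (intro mult_mono)
      show "norm (v S) \<le> R + S * (11 / 10)"
        using nv(1)[of S] SS mult_left_mono[OF y1, of S] by linarith
    qed (use b R in auto)
    also have "\<dots> = (3 / 4 * R + 33 / 40 * S) * R" by (simp add: algebra_simps)
    also have "\<dots> \<le> ?p (v S) * R"
    proof (intro mult_right_mono)
      show "3 / 4 * R + 33 / 40 * S \<le> ?p (v S)" using pv[of S] pu a0 SS R by linarith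
    qed (use R in simp)
    finally have "0 \<le> ?p (v S) * R - b * norm (v S)" by simp
    moreover have "?p (v s0) * R - b * norm (v s0) \<le> 0" using 3 by simp
    moreover have "continuous_on {s0..S} (\<lambda>s. ?p (v s) * R - b * norm (v s))"
      unfolding pv v_def by (intro continuous_intros)
    ultimately obtain s where s: "s0 \<le> s" "?p (v s) * R - b * norm (v s) = 0"
      using IVT'[of "\<lambda>s. ?p (v s) * R - b * norm (v s)" s0 0 S] SS by blast
    have "b * R \<le> ?p (v s) * R" using s(1) pv[of s] pu R by (simp add: s0_def)
    then have "b * R \<le> b * norm (v s)" using s by simp
    then have ge: "R \<le> norm (v s)" using b0 by simp
    have "s * R = ?p (v s) * R - ?p u * R" by (simp add: pv algebra_simps)
    also have "\<dots> \<le> b * norm (v s) + a * R"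
      using s pu R mult_right_mono[of "- ?p u" a R] by auto
    also have "a * R \<le> a * norm (v s)" using ge a0 by (intro mult_left_mono)
    finally have "s * R \<le> (a + b) * norm (v s)" by (simp add: algebra_simps)
    then show thesis using big[of s] s ge by simp
  qed
qed

lemma frontier_near_midpoint:
  assumes x1: "x1 \<in> frontier A" and x2: "x2 \<in> frontier A"
    and t: "norm (x2 - x1) = t" "0 < t" "t < T" and g: "dev t + 2 * dev (t / 2) < g"
  shows "cball ((1/2) *\<^sub>R (x1 + x2)) g \<inter> frontier A \<noteq> {}"
proof -
  interpret C: smooth_region "closure (- A)" "\<lambda>x. - N x" \<alpha> T by (rule complementary)
  obtain w where w: "w \<notin> A" "norm (w - (1/2) *\<^sub>R (x1 + x2)) \<le> g"
    using point_outside_near_midpoint[OF assms] by blast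
  obtain w' where w': "w' \<notin> closure (- A)" "norm (w' - (1/2) *\<^sub>R (x1 + x2)) \<le> g"
    using C.point_outside_near_midpoint[of x1 x2 t g] assms
    unfolding dev_complementary frontier_closure_Compl by blast
  let ?B = "cball ((1/2) *\<^sub>R (x1 + x2)) g"
  have "w' \<in> A" using w'(1) by (auto simp: closure_def)
  moreover have "w \<in> ?B" "w' \<in> ?B" using w w' by (simp_all add: dist_norm norm_minus_commute)
  moreover have "connected ?B" by (rule convex_connected) (rule convex_cball)
  ultimately show ?thesis
    using w(1) connected_Int_frontier[of ?B A] by blast
qed

text \<open>Monotonicity of \<open>dev\<close> makes the midpoint bound at distance
  \<open>\<tau>\<close> valid for all closer pairs.\<close>

lemma gamma0_frontier_le:
  assumes "0 < \<tau>" "\<tau> < T"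
  shows "gamma0 (frontier A) \<tau> \<le> dev \<tau> + 2 * dev (\<tau> / 2)"
proof (rule dense_ge)
  fix g assume g: "dev \<tau> + 2 * dev (\<tau> / 2) < g"
  have g0: "g > 0" using g dev_nonneg[of \<tau>] dev_nonneg[of "\<tau> / 2"] by linarith
  have "cball ((1/2) *\<^sub>R (x1 + x2)) g \<inter> frontier A \<noteq> {}"
    if x: "x1 \<in> frontier A" "x2 \<in> frontier A" "norm (x1 - x2) \<le> \<tau>" for x1 x2
  proof (cases "x1 = x2")
    case True
    then have "(1/2) *\<^sub>R (x1 + x2) = x1" by (simp flip: scaleR_2)
    then have "x1 \<in> cball ((1/2) *\<^sub>R (x1 + x2)) g" using g0 by simp
    then show ?thesis using x by blast
  next
    case False
    define t where "t = norm (x2 - x1)"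
    have t: "0 < t" "t \<le> \<tau>" using False x by (auto simp: t_def norm_minus_commute)
    have "dev t \<le> dev \<tau>" "dev (t / 2) \<le> dev (\<tau> / 2)"
      using t assms by (auto intro!: dev_mono)
    then show ?thesis
      using frontier_near_midpoint[OF x(1,2), of t g] t g assms by (simp add: t_def)
  qed
  then show "gamma0 (frontier A) \<tau> \<le> g"
    unfolding gamma0_def using g0 by (intro cInf_lower) (auto intro!: bdd_belowI[of _ 0])
qed

end

section \<open>The modulus of nonconvexity as a right limit\<close>

lemma gamma0_nonneg: "0 < \<epsilon> \<Longrightarrow> 0 \<le> gamma0 S \<epsilon>"
  and gamma0_mono: "0 < \<epsilon> \<Longrightarrow> \<epsilon> \<le> \<epsilon>' \<Longrightarrow> gamma0 S \<epsilon> \<le> gamma0 S \<epsilon>'"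
proof -
  \<comment> \<open>The radius \<open>\<epsilon>\<close> is always admissible, since
    \<open>x1\<close> lies within \<open>\<epsilon> / 2\<close> of the midpoint; the infimum is thus
    over a nonempty set.\<close>
  have ne: "{\<gamma>. \<gamma> > 0 \<and> (\<forall>x1\<in>S. \<forall>x2\<in>S. norm (x1 - x2) \<le> \<epsilon> \<longrightarrow>
       cball ((1/2) *\<^sub>R (x1 + x2)) \<gamma> \<inter> S \<noteq> {})} \<noteq> {}" if "0 < \<epsilon>" for \<epsilon>
  proof -
    have "cball ((1/2) *\<^sub>R (x1 + x2)) \<epsilon> \<inter> S \<noteq> {}"
      if "x1 \<in> S" "norm (x1 - x2) \<le> \<epsilon>" for x1 x2
    proof -
      have "(1/2) *\<^sub>R (x1 + x2) - x1 = (1/2) *\<^sub>R (x2 - x1)"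
      proof -
        have "x1 = (1/2) *\<^sub>R x1 + (1/2) *\<^sub>R x1" by (simp flip: scaleR_left.add)
        then show ?thesis by (simp add: algebra_simps)
      qed
      then have "dist ((1/2) *\<^sub>R (x1 + x2)) x1 = norm (x1 - x2) / 2"
        by (simp add: dist_norm norm_minus_commute)
      then have "x1 \<in> cball ((1/2) *\<^sub>R (x1 + x2)) \<epsilon>"
        using that \<open>0 < \<epsilon>\<close> by simp
      with that show ?thesis by blast
    qed
    then show ?thesis using that by blast
  qed
  show "0 < \<epsilon> \<Longrightarrow> 0 \<le> gamma0 S \<epsilon>"
    unfolding gamma0_def by (rule cInf_greatest[OF ne]) auto
  show "0 < \<epsilon> \<Longrightarrow> \<epsilon> \<le> \<epsilon>' \<Longrightarrow> gamma0 S \<epsilon> \<le> gamma0 S \<epsilon>'"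
    unfolding gamma0_def
    by (rule cInf_superset_mono[OF ne]) (auto intro!: bdd_belowI[of _ 0])
qed

text \<open>As \<open>gamma0 S\<close> is monotone and bounded below to the right of
  \<open>\<epsilon>\<close>, its right limit exists and is the infimum there.\<close>

lemma modulus_nonconvexity_le_gamma0:
  assumes "0 < \<epsilon>" "\<epsilon> < \<tau>"
  shows "modulus_nonconvexity S \<epsilon> \<le> gamma0 S \<tau>"
proof -
  define L where "L = Inf (gamma0 S ` {\<epsilon><..})"
  have bdd: "bdd_below (gamma0 S ` {\<epsilon><..})"
    using assms by (intro bdd_belowI[of _ 0]) (auto intro!: gamma0_nonneg)
  have low: "L \<le> gamma0 S t" if "t > \<epsilon>" for t
    unfolding L_def using that by (intro cInf_lower[OF _ bdd]) auto
  have "(gamma0 S \<longlongrightarrow> L) (at_right \<epsilon>)"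
  proof (rule order_tendstoI)
    fix a assume "a < L"
    then show "\<forall>\<^sub>F t in at_right \<epsilon>. a < gamma0 S t"
      using low by (auto simp: eventually_at_right_field intro!: exI[of _ "\<epsilon> + 1"] intro: less_le_trans)
  next
    fix a assume "L < a"
    then obtain t where "t > \<epsilon>" "gamma0 S t < a"
      unfolding L_def by (subst (asm) cInf_less_iff[OF _ bdd]) auto
    moreover have "gamma0 S y \<le> gamma0 S t" if "\<epsilon> < y" "y < t" for y
      using that assms by (intro gamma0_mono) auto
    ultimately show "\<forall>\<^sub>F t in at_right \<epsilon>. gamma0 S t < a"
      unfolding eventually_at_right_field by (intro exI[of _ t]) (auto intro: le_less_trans)
  qed
  then have "Lim (at_right \<epsilon>) (gamma0 S) = L"
    by (intro tendsto_Lim) auto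
  then show ?thesis using assms low by (simp add: modulus_nonconvexity_def)
qed

text \<open>The modulus is at most \<open>gamma0\<close> at \<open>\<epsilon> + h\<close>, and
  \<open>dev_step_down\<close> at \<open>\<epsilon>\<close> and \<open>\<epsilon> / 2\<close> brings
  the bound back to \<open>\<epsilon>\<close>. The factor \<open>2\<close> before
  \<open>dev (\<epsilon> / 2)\<close> cancels the half in \<open>dev_le\<close>.\<close>

lemma (in smooth_region) modulus_nonconvexity_frontier_le:
  assumes \<epsilon>: "0 < \<epsilon>" "\<epsilon> < T"
  shows "modulus_nonconvexity (frontier A) \<epsilon> \<le> \<epsilon> * (\<alpha> \<epsilon> + \<alpha> (\<epsilon> / 2))"
proof (rule field_le_epsilon)
  fix \<kappa> :: real assume \<kappa>: "\<kappa> > 0"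
  obtain k1 where k1: "k1 > 0"
    "\<And>\<tau>. \<epsilon> < \<tau> \<Longrightarrow> \<tau> \<le> \<epsilon> + k1 \<Longrightarrow> \<tau> < T \<Longrightarrow> dev \<tau> \<le> dev \<epsilon> + 8 * (\<tau> - \<epsilon>)"
    using dev_step_down[OF \<epsilon>(1)] by blast
  obtain k2 where k2: "k2 > 0"
    "\<And>\<tau>. \<epsilon> / 2 < \<tau> \<Longrightarrow> \<tau> \<le> \<epsilon> / 2 + k2 \<Longrightarrow> \<tau> < T \<Longrightarrow> dev \<tau> \<le> dev (\<epsilon> / 2) + 8 * (\<tau> - \<epsilon> / 2)"
    using dev_step_down[of "\<epsilon> / 2"] \<epsilon> by auto
  \<comment> \<open>Each of the two deviation terms contributes \<open>8 * h\<close>, whence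
    \<open>\<kappa> / 16\<close>; the bound \<open>(T - \<epsilon>) / 2\<close> keeps
    \<open>\<epsilon> + h\<close> below \<open>T\<close>.\<close>
  define h where "h = min (min k1 k2) (min ((T - \<epsilon>) / 2) (\<kappa> / 16))"
  have h: "0 < h" "h \<le> k1" "h \<le> k2" "h \<le> (T - \<epsilon>) / 2" "h \<le> \<kappa> / 16"
    using k1(1) k2(1) \<epsilon> \<kappa> by (simp_all add: h_def min.coboundedI1 min.coboundedI2 del: le_divide_eq_numeral1)
  have hT: "\<epsilon> + h < T" using h \<epsilon> by (simp add: field_simps)
  have "modulus_nonconvexity (frontier A) \<epsilon> \<le> gamma0 (frontier A) (\<epsilon> + h)"
    using \<epsilon> h by (intro modulus_nonconvexity_le_gamma0) auto
  also have "\<dots> \<le> dev (\<epsilon> + h) + 2 * dev ((\<epsilon> + h) / 2)"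
    using \<epsilon> h hT by (intro gamma0_frontier_le) auto
  also have "\<dots> \<le> (dev \<epsilon> + 8 * h) + 2 * (dev (\<epsilon> / 2) + 4 * h)"
  proof -
    have "dev (\<epsilon> + h) \<le> dev \<epsilon> + 8 * h" using k1(2)[of "\<epsilon> + h"] h hT by simp
    moreover have "(\<epsilon> + h) / 2 \<le> \<epsilon> / 2 + k2" "(\<epsilon> + h) / 2 < T" using h hT \<epsilon> by auto
    then have "dev ((\<epsilon> + h) / 2) \<le> dev (\<epsilon> / 2) + 8 * ((\<epsilon> + h) / 2 - \<epsilon> / 2)"
      using h by (intro k2(2)) auto
    then have "dev ((\<epsilon> + h) / 2) \<le> dev (\<epsilon> / 2) + 4 * h" by (simp add: add_divide_distrib)
    ultimately show ?thesis by simp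
  qed
  also have "\<dots> \<le> dev \<epsilon> + 2 * dev (\<epsilon> / 2) + \<kappa>" using h by simp
  also have "\<dots> \<le> \<epsilon> * (\<alpha> \<epsilon> + \<alpha> (\<epsilon> / 2)) + \<kappa>"
    using dev_le[of \<epsilon>] dev_le[of "\<epsilon> / 2"] \<epsilon> by (simp add: algebra_simps)
  finally show "modulus_nonconvexity (frontier A) \<epsilon> \<le> \<epsilon> * (\<alpha> \<epsilon> + \<alpha> (\<epsilon> / 2)) + \<kappa>" .
qed

section \<open>From smooth closed surfaces to the modulus bound\<close>

text \<open>The unit normals \<open>p\<close> of \<open>A\<close> and \<open>- p\<close> of
  \<open>closure (- A)\<close> lie in the cones described by the common \<alpha>, which gives
  \<open>inner\<close> and \<open>outer\<close> after reversing \<open>x - a\<close>.\<close>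

lemma smooth_region_of_smooth_closed_surface:
  assumes "closed A" "closure (interior A) = A" and smooth: "smooth_closed_surface A \<alpha>"
    and "\<And>t. 0 < t \<Longrightarrow> t < T \<Longrightarrow> \<alpha> t < 1 / 2"
  obtains N where "smooth_region A N \<alpha> T"
proof -
  have "\<exists>p. norm p = 1 \<and>
     (\<forall>a\<in>A. blinfun_apply p (a - x) \<le> \<alpha> (norm (a - x)) * norm (a - x)) \<and>
     (\<forall>a\<in>closure (- A). - blinfun_apply p (a - x) \<le> \<alpha> (norm (a - x)) * norm (a - x))"
    if "x \<in> frontier A" for x
  proof -
    note smooth_x = smooth[unfolded smooth_closed_surface_def,
      THEN conjunct2, THEN conjunct2, THEN conjunct2, THEN bspec, OF that]
    obtain p where p: "normal_cone A x \<inter> sphere 0 1 = {p}"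
      "normal_cone (closure (- A)) x \<inter> sphere 0 1 = {- p}"
      using smooth_x[THEN conjunct1] by (elim exE conjE) (rule that)
    from p have "p \<in> normal_cone A x \<inter> sphere 0 1" "- p \<in> normal_cone (closure (- A)) x \<inter> sphere 0 1"
      by simp_all
    then have "p \<in> normal_cone A x" "- p \<in> normal_cone (closure (- A)) x" and n: "norm p = 1"
      by simp_all
    then have "\<forall>a\<in>A. blinfun_apply p (x - a) \<ge> - \<alpha> (norm (x - a)) * norm (x - a)"
      "\<forall>a\<in>closure (- A). blinfun_apply (- p) (x - a) \<ge> - \<alpha> (norm (x - a)) * norm (x - a)"
      unfolding smooth_x[THEN conjunct2, THEN conjunct1] smooth_x[THEN conjunct2, THEN conjunct2]
      by simp_all
    moreover have "blinfun_apply p (x - a) = - blinfun_apply p (a - x)" for a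
      by (simp add: blinfun.diff_right)
    ultimately show ?thesis
      using n by (intro exI[of _ p]) (auto simp: norm_minus_commute blinfun.minus_left)
  qed
  then obtain N where "\<And>x. x \<in> frontier A \<Longrightarrow> norm (N x) = 1 \<and>
     (\<forall>a\<in>A. blinfun_apply (N x) (a - x) \<le> \<alpha> (norm (a - x)) * norm (a - x)) \<and>
     (\<forall>a\<in>closure (- A). - blinfun_apply (N x) (a - x) \<le> \<alpha> (norm (a - x)) * norm (a - x))"
    by metis
  then have "smooth_region A N \<alpha> T"
    using assms unfolding smooth_region_def smooth_closed_surface_def by auto
  then show thesis by (rule that)
qed

theorem theorem5p1:
  fixes A :: "'a::banach set" and \<alpha> :: "real \<Rightarrow> real" and r :: real
  assumes "reflexive_space TYPE('a)"
    and "closed A" and "closure (interior A) = A"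
    and "smooth_closed_surface A \<alpha>"
    and "simple_surface A r"
  defines "\<epsilon>0 \<equiv> Sup {ereal t | t. t > 0 \<and>
                     (\<forall>\<tau>. 0 < \<tau> \<and> \<tau> < t \<longrightarrow> \<alpha> \<tau> + \<alpha> (\<tau> / 2) < 1 / 2)}"
  shows "weakly_convex_on (frontier A) (min (ereal r) \<epsilon>0) \<and>
         (\<forall>\<epsilon>. 0 \<le> \<epsilon> \<and> ereal \<epsilon> < min (ereal r) \<epsilon>0 \<longrightarrow>
            modulus_nonconvexity (frontier A) \<epsilon> \<le> \<epsilon> * (\<alpha> \<epsilon> + \<alpha> (\<epsilon> / 2)))"
proof -
  have \<alpha>_nonneg: "\<alpha> t \<ge> 0" if "t \<ge> 0" for t
    using assms(4) that unfolding smooth_closed_surface_def by blast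
  have main: "modulus_nonconvexity (frontier A) \<epsilon> \<le> \<epsilon> * (\<alpha> \<epsilon> + \<alpha> (\<epsilon> / 2))"
    "\<alpha> \<epsilon> + \<alpha> (\<epsilon> / 2) < 1 / 2" if \<epsilon>: "0 < \<epsilon>" "ereal \<epsilon> < \<epsilon>0" for \<epsilon>
  proof -
    \<comment> \<open>A \<open>T\<close> strictly beyond \<open>\<epsilon>\<close> leaves room for
      the right limit.\<close>
    from \<epsilon>(2) obtain T where T: "\<epsilon> < T" "\<And>\<tau>. 0 < \<tau> \<Longrightarrow> \<tau> < T \<Longrightarrow> \<alpha> \<tau> + \<alpha> (\<tau> / 2) < 1 / 2"
      unfolding \<epsilon>0_def less_Sup_iff by auto
    show "\<alpha> \<epsilon> + \<alpha> (\<epsilon> / 2) < 1 / 2" using T \<epsilon> by blast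
    have "\<alpha> t < 1 / 2" if "0 < t" "t < T" for t
      using T(2)[OF that] \<alpha>_nonneg[of "t / 2"] that by linarith
    then obtain N where "smooth_region A N \<alpha> T"
      using smooth_region_of_smooth_closed_surface[OF assms(2,3,4)] by blast
    from smooth_region.modulus_nonconvexity_frontier_le[OF this \<epsilon>(1) T(1)]
    show "modulus_nonconvexity (frontier A) \<epsilon> \<le> \<epsilon> * (\<alpha> \<epsilon> + \<alpha> (\<epsilon> / 2))" .
  qed
  have "modulus_nonconvexity (frontier A) \<epsilon> < \<epsilon> / 2" if "0 < \<epsilon>" "ereal \<epsilon> < \<epsilon>0" for \<epsilon>
    using main[OF that] mult_strict_left_mono[OF main(2)[OF that] that(1)] by linarith
  moreover have "modulus_nonconvexity (frontier A) 0 = 0" by (simp add: modulus_nonconvexity_def)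
  ultimately show ?thesis
    using main(1) unfolding weakly_convex_on_def le_less[of "0::real"] by auto
qed

end
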